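(* For the fully online matching problem on bipartite graphs (integral version), the Ranking algorithm is $\Omega$-competitive, where $\Omega\approx0.5671$ is the unique real solution of $\Omega e^{\Omega}=1$: on every bipartite instance, $\mathbb{E}_{\mathbf y}[|M(\mathbf y)|]\ge\Omega\cdot\mathrm{OPT}$, where $\mathrm{OPT}$ is the maximum matching size.
   Context: Fully online matching model: an undirected graph $G=(V,E)$ is revealed online; each step is the arrival or the deadline of a vertex; at $v$'s arrival, the edges between $v$ and previously arrived vertices are revealed; every neighbor of $v$ arrives before $v$'s deadline. At a vertex's deadline, if it is unmatched, the algorithm must irrevocably either match it to a currently unmatched neighbor or leave it unmatched. Ranking: when a vertex $v$ arrives, it draws a rank $y_v\in[0,1)$ independently and uniformly at random; when the deadline of $v$ is reached and $v$ is unmatched, let $N(v)$ be its set of unmatched neighbors; if $N(v)\neq\emptyset$, match $v$ to $\arg\min_{u\in N(v)}y_u$, otherwise leave $v$ unmatched. $M(\mathbf y)$ denotes the matching produced with rank vector $\mathbf y$. *)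

theory Defs
  imports "HOL-Probability.Probability"
begin

definition simple_graph :: "'a set \<Rightarrow> ('a \<Rightarrow> 'a \<Rightarrow> bool) \<Rightarrow> bool" where
  "simple_graph V E \<longleftrightarrow> finite V \<and> (\<forall>u v. E u v \<longrightarrow> E v u)
      \<and> (\<forall>v. \<not> E v v) \<and> (\<forall>u v. E u v \<longrightarrow> u \<in> V \<and> v \<in> V)"

definition bipartite :: "'a set \<Rightarrow> ('a \<Rightarrow> 'a \<Rightarrow> bool) \<Rightarrow> bool" where
  "bipartite V E \<longleftrightarrow> (\<exists>L R. L \<inter> R = {} \<and> L \<union> R = V \<and>
      (\<forall>u v. E u v \<longrightarrow> (u \<in> L \<and> v \<in> R) \<or> (u \<in> R \<and> v \<in> L)))"

definition is_matching :: "('a \<Rightarrow> 'a \<Rightarrow> bool) \<Rightarrow> 'a set set \<Rightarrow> bool" where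
  "is_matching E M \<longleftrightarrow> (\<forall>e\<in>M. \<exists>u v. e = {u, v} \<and> E u v)
      \<and> (\<forall>e\<in>M. \<forall>e'\<in>M. e \<noteq> e' \<longrightarrow> e \<inter> e' = {})"

definition max_matching_size :: "('a \<Rightarrow> 'a \<Rightarrow> bool) \<Rightarrow> nat" where
  "max_matching_size E = Max (card ` {M. is_matching E M})"

datatype 'a event = Arrive 'a | Deadline 'a

definition fully_online_instance ::
  "'a set \<Rightarrow> ('a \<Rightarrow> 'a \<Rightarrow> bool) \<Rightarrow> 'a event list \<Rightarrow> bool" where
  "fully_online_instance V E evs \<longleftrightarrow>
     distinct evs \<and> set evs = Arrive ` V \<union> Deadline ` V \<and>
     (\<forall>i j v. i < length evs \<and> j < length evs \<and> evs ! i = Arrive v \<and> evs ! j = Deadline v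
        \<longrightarrow> i < j) \<and>
     (\<forall>i j u v. i < length evs \<and> j < length evs \<and> E u v \<and> evs ! i = Arrive u
        \<and> evs ! j = Deadline v \<longrightarrow> i < j)"

text \<open>Step at the deadline of v, with current matching M (matched vertices are the union
  of M): if v is unmatched and has unmatched neighbours, match v to the neighbour of
  minimum rank (ties, a null event, broken arbitrarily by arg_min_on).\<close>
definition ranking_deadline ::
  "('a \<Rightarrow> 'a \<Rightarrow> bool) \<Rightarrow> ('a \<Rightarrow> real) \<Rightarrow> 'a \<Rightarrow> 'a set set \<Rightarrow> 'a set set" where
  "ranking_deadline E y v M =
     (if v \<in> \<Union>M then M
      else (let N = {u. E u v \<and> u \<notin> \<Union>M} in
            if N = {} then M else insert {arg_min_on y N, v} M))"

fun ranking_run ::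
  "('a \<Rightarrow> 'a \<Rightarrow> bool) \<Rightarrow> ('a \<Rightarrow> real) \<Rightarrow> 'a event list \<Rightarrow> 'a set set \<Rightarrow> 'a set set" where
  "ranking_run E y [] M = M"
| "ranking_run E y (Arrive v # es) M = ranking_run E y es M"
| "ranking_run E y (Deadline v # es) M = ranking_run E y es (ranking_deadline E y v M)"

definition ranking ::
  "('a \<Rightarrow> 'a \<Rightarrow> bool) \<Rightarrow> 'a event list \<Rightarrow> ('a \<Rightarrow> real) \<Rightarrow> 'a set set" where
  "ranking E evs y = ranking_run E y evs {}"

definition rank_space :: "'a set \<Rightarrow> ('a \<Rightarrow> real) measure" where
  "rank_space V = PiM V (\<lambda>_. uniform_measure lborel {0..<1})"

definition omega_const :: real where
  "omega_const = (THE w::real. w * exp w = 1)"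

end

theory Submission
  imports Defs
begin

text \<open>
  Every edge of the matching is split between the vertex whose deadline created it (active) and its
  partner (passive): a passive vertex of rank \<open>t\<close> gains \<open>price t\<close> and its active partner the
  remaining \<open>1 - price t\<close>. It suffices that the endpoints of every edge \<open>u v\<close>, with the deadline of \<open>u\<close>
  coming first, gain \<open>omega_const\<close> together in expectation over their two ranks, all other ranks being
  fixed. Let \<open>\<tau>\<close> be the rank below which \<open>v\<close> is passive if \<open>u\<close> is deleted. By bipartiteness, deleting
  one endpoint never helps the other one, so below \<open>\<tau>\<close> the vertex \<open>v\<close> gains its price
  whatever the rank of \<open>u\<close>. If \<open>u\<close> is passive with \<open>v\<close> deleted, it gains its price. Otherwise,
  for ranks of \<open>v\<close> above \<open>\<tau>\<close>, both endpoints survive until the deadline of \<open>u\<close>, which then takes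
  \<open>v\<close> itself (total gain 1) or a rival whose rank does not depend on the two ranks; below \<open>\<tau>\<close>, the
  vertex \<open>u\<close> is no worse off than with \<open>v\<close> deleted, up to having become passive.
\<close>

section \<open>Runs of Ranking and their monotonicity\<close>

definition avail :: "('a \<Rightarrow> 'a \<Rightarrow> bool) \<Rightarrow> 'a \<Rightarrow> 'a set \<Rightarrow> 'a set" where
  "avail E x X = {p. E p x \<and> p \<notin> X}"

definition pick :: "('a \<Rightarrow> 'a \<Rightarrow> bool) \<Rightarrow> ('a \<Rightarrow> real) \<Rightarrow> 'a \<Rightarrow> 'a set \<Rightarrow> 'a" where
  "pick E y x X = arg_min_on y (avail E x X)"

definition step :: "('a \<Rightarrow> 'a \<Rightarrow> bool) \<Rightarrow> ('a \<Rightarrow> real) \<Rightarrow> 'a \<Rightarrow> 'a set \<Rightarrow> 'a set" where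
  "step E y x X = (if x \<in> X \<or> avail E x X = {} then X else insert (pick E y x X) (insert x X))"

abbreviation run :: "('a \<Rightarrow> 'a \<Rightarrow> bool) \<Rightarrow> ('a \<Rightarrow> real) \<Rightarrow> 'a list \<Rightarrow> 'a set \<Rightarrow> 'a set" where
  "run E y xs X \<equiv> fold (step E y) xs X"

text \<open>The pairs are (active, passive): the first vertex is matched at its own deadline. A run starting
  from a nonempty set \<open>X\<close> is a run in the graph with the vertices of \<open>X\<close> deleted.\<close>
fun match_list ::
  "('a \<Rightarrow> 'a \<Rightarrow> bool) \<Rightarrow> ('a \<Rightarrow> real) \<Rightarrow> 'a list \<Rightarrow> 'a set \<Rightarrow> ('a \<times> 'a) list" where
  "match_list E y [] X = []"
| "match_list E y (x # xs) X =
     (if x \<in> X \<or> avail E x X = {} then match_list E y xs X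
      else (x, pick E y x X) # match_list E y xs (step E y x X))"

lemma match_list_append:
  "match_list E y (xs @ zs) X = match_list E y xs X @ match_list E y zs (run E y xs X)"
  by (induction xs arbitrary: X) (auto simp: step_def)

lemma step_mono: "X \<subseteq> step E y x X"
  by (auto simp: step_def)

lemma run_mono: "X \<subseteq> run E y xs X"
proof (induction xs arbitrary: X)
  case (Cons x xs)
  show ?case using Cons[of "step E y x X"] step_mono[of X E y x] by auto
qed simp

text \<open>A vertex whose own deadline is not among \<open>xs\<close> can be matched only as the
  choice of another vertex, hence as the passive end of a pair.\<close>

lemma passive_in_match_list:
  assumes "w \<in> run E y xs X" "w \<notin> X" "w \<notin> set xs"
  shows "\<exists>s. (s, w) \<in> set (match_list E y xs X)"
  using assms
proof (induction xs arbitrary: X)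
  case (Cons x xs)
  show ?case
  proof (cases "w \<in> step E y x X")
    case True
    then show ?thesis using Cons.prems by (auto simp: step_def split: if_splits)
  next
    case False
    then show ?thesis using Cons.IH[of "step E y x X"] Cons.prems
      by (auto simp: step_def split: if_splits)
  qed
qed simp

text \<open>Arrivals do not change the matching, so the order of the deadlines determines the
  run.\<close>

fun deadlines :: "'a event list \<Rightarrow> 'a list" where
  "deadlines [] = []"
| "deadlines (Arrive v # es) = deadlines es"
| "deadlines (Deadline v # es) = v # deadlines es"

lemma set_deadlines: "set (deadlines es) = {v. Deadline v \<in> set es}"
  by (induction es rule: deadlines.induct) auto

lemma distinct_deadlines: "distinct es \<Longrightarrow> distinct (deadlines es)"
  by (induction es rule: deadlines.induct) (auto simp: set_deadlines)

section \<open>How a single vertex or rank influences a run\<close>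

locale bipartite_graph =
  fixes V :: "'a set" and E :: "'a \<Rightarrow> 'a \<Rightarrow> bool" and side :: "'a \<Rightarrow> bool"
  assumes finite_V: "finite V"
    and E_sym: "E u v \<Longrightarrow> E v u"
    and E_V: "E u v \<Longrightarrow> u \<in> V"
    and E_side: "E u v \<Longrightarrow> side u \<noteq> side v"
begin

lemma avail_subset: "avail E x X \<subseteq> V"
  using E_V by (auto simp: avail_def)

lemma finite_avail: "finite (avail E x X)"
  using avail_subset finite_V by (rule finite_subset)

lemma pick_in: "avail E x X \<noteq> {} \<Longrightarrow> pick E y x X \<in> avail E x X"
  unfolding pick_def by (rule arg_min_if_finite(1)[OF finite_avail])

lemma pick_le: "p \<in> avail E x X \<Longrightarrow> y (pick E y x X) \<le> y p"
  unfolding pick_def by (rule arg_min_least[OF finite_avail]) auto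

text \<open>Injective ranks make the minimiser unique; this keeps ties in \<open>arg_min_on\<close>
  out of the comparisons of runs.\<close>

lemma pick_eq:
  assumes "inj_on y V" "p \<in> avail E x X" "\<And>q. q \<in> avail E x X \<Longrightarrow> y p \<le> y q"
  shows "pick E y x X = p"
proof -
  have *: "pick E y x X \<in> avail E x X" using assms(2) pick_in by auto
  have "y (pick E y x X) = y p" using pick_le[OF assms(2), of y] assms(3)[OF *] by simp
  then show ?thesis using assms(1,2) * avail_subset by (auto dest: inj_onD)
qed

lemma pick_insert:
  assumes "inj_on y V" "avail E x X \<noteq> {}" "pick E y x X \<noteq> w"
  shows "pick E y x (insert w X) = pick E y x X" "avail E x (insert w X) \<noteq> {}"
proof -
  have *: "pick E y x X \<in> avail E x (insert w X)"
    using pick_in[OF assms(2), of y] assms(3) by (auto simp: avail_def)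
  then show "avail E x (insert w X) \<noteq> {}" by auto
  show "pick E y x (insert w X) = pick E y x X"
    by (rule pick_eq[OF assms(1) *]) (auto intro!: pick_le simp: avail_def)
qed

text \<open>A minimum is insensitive to the loss of a candidate that does not attain it, so deleting
  a vertex that stays unmatched does not alter the step.\<close>

lemma step_insert:
  assumes "inj_on y V" "w \<notin> step E y x X" "w \<noteq> x"
  shows "step E y x (insert w X) = insert w (step E y x X)"
proof (cases "x \<in> X \<or> avail E x X = {}")
  case True
  then show ?thesis by (auto simp: step_def avail_def)
next
  case False
  then have "pick E y x X \<noteq> w" using assms(2) by (auto simp: step_def)
  with pick_insert[OF assms(1) _ this] False show ?thesis using assms(3) by (auto simp: step_def)
qed

lemma run_insert:
  assumes "inj_on y V" "w \<notin> run E y xs X" "w \<notin> set xs"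
  shows "run E y xs (insert w X) = insert w (run E y xs X)"
  using assms(2,3)
proof (induction xs arbitrary: X)
  case (Cons x xs)
  then have "w \<notin> step E y x X" using run_mono[of "step E y x X" E y xs] by auto
  then show ?case using Cons by (simp add: step_insert[OF assms(1)])
qed simp

text \<open>An unmatched pair has no influence on the run, so the first of the two to be matched is matched
  in the absence of the other as well.\<close>
lemma run_two_unmatched:
  assumes "inj_on y V" "u \<notin> run E y xs (insert v X)" "v \<notin> run E y xs (insert u X)"
    "u \<notin> set xs" "v \<notin> set xs" "u \<notin> X" "v \<notin> X" "u \<noteq> v"
  shows "u \<notin> run E y xs X \<and> v \<notin> run E y xs X"
  using assms(2-)
proof (induction xs arbitrary: X)
  case (Cons x xs)
  have not_picked: "w \<notin> step E y x X"
    if w: "w \<notin> run E y (x # xs) (insert w' X)" "w \<notin> X" "w \<noteq> x" "w' \<noteq> x" "w \<noteq> w'" for w w'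
  proof
    assume "w \<in> step E y x X"
    then have *: "x \<notin> X" "avail E x X \<noteq> {}" "pick E y x X = w"
      using w by (auto simp: step_def split: if_splits)
    then have "w \<in> step E y x (insert w' X)"
      using pick_insert[OF assms(1) *(2), of w'] w(4,5) by (auto simp: step_def)
    then show False using w(1) run_mono[of "step E y x (insert w' X)" E y xs] by auto
  qed
  have u: "u \<notin> step E y x X" using Cons.prems by (intro not_picked[of u v]) auto
  have v: "v \<notin> step E y x X" using Cons.prems by (intro not_picked[of v u]) auto
  have "u \<noteq> x" "v \<noteq> x" using Cons.prems by auto
  note s = step_insert[OF assms(1) u this(1)] step_insert[OF assms(1) v this(2)]
  show ?case using Cons.IH[of "step E y x X"] Cons.prems s u v by simp
qed simp

text \<open>As long as \<open>w\<close> is not chosen under \<open>y'\<close>, both runs coincide: a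
  vertex that beats \<open>w\<close> at its smaller rank beats it at the larger one too.\<close>

lemma run_smaller_rank:
  assumes "inj_on y V" "inj_on y' V" "\<And>p. p \<noteq> w \<Longrightarrow> y' p = y p" "y' w \<le> y w"
    "w \<in> run E y xs X" "w \<notin> set xs"
  shows "w \<in> run E y' xs X"
  using assms(5-)
proof (induction xs arbitrary: X)
  case (Cons x xs)
  show ?case
  proof (cases "w \<in> step E y' x X")
    case True
    then show ?thesis using run_mono[of "step E y' x X" E y' xs] by auto
  next
    case False
    have "step E y' x X = step E y x X"
    proof (cases "x \<in> X \<or> avail E x X = {}")
      case False': False
      let ?p = "pick E y' x X"
      have p: "?p \<in> avail E x X" using False' by (intro pick_in) auto
      have "?p \<noteq> w" using False False' by (auto simp: step_def)
      have "pick E y x X = ?p"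
      proof (rule pick_eq[OF assms(1) p])
        fix q assume "q \<in> avail E x X"
        then have "y' ?p \<le> y' q" by (rule pick_le)
        also have "\<dots> \<le> y q" using assms(3,4) by (cases "q = w") auto
        finally show "y ?p \<le> y q" using assms(3)[OF \<open>?p \<noteq> w\<close>] by simp
      qed
      then show ?thesis by (simp add: step_def)
    qed (auto simp: step_def)
    then show ?thesis using Cons by simp
  qed
qed simp

text \<open>Only ranks of available vertices are compared, and vertices of \<open>X\<close> are
  never available. Runs with a deleted vertex are therefore independent of its rank.\<close>

lemma run_rank_cong:
  assumes "inj_on y V" "inj_on y' V" "\<And>p. p \<notin> X \<Longrightarrow> y' p = y p"
  shows "run E y' xs X = run E y xs X"
  using assms(3)
proof (induction xs arbitrary: X)
  case (Cons x xs)
  have "pick E y x X = pick E y' x X" if "avail E x X \<noteq> {}"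
  proof (rule pick_eq[OF assms(1) pick_in[OF that]])
    fix q assume q: "q \<in> avail E x X"
    with pick_in[OF that, of y'] show "y (pick E y' x X) \<le> y q"
      using Cons.prems pick_le[OF q, of y'] by (auto simp: avail_def)
  qed
  then have "step E y' x X = step E y x X" by (auto simp: step_def)
  moreover have "run E y' xs (step E y x X) = run E y xs (step E y x X)"
    using Cons.prems step_mono[of X E y x] by (intro Cons.IH) auto
  ultimately show ?case by simp
qed simp

text \<open>Adding a vertex to one side can only help the other side: fewer vertices on its own side and
  more vertices on the other side are matched at any time.\<close>
definition dominated :: "bool \<Rightarrow> 'a set \<Rightarrow> 'a set \<Rightarrow> bool" where
  "dominated s X Y \<longleftrightarrow> (\<forall>x. (side x = s \<longrightarrow> x \<in> X \<longrightarrow> x \<in> Y) \<and> (side x \<noteq> s \<longrightarrow> x \<in> Y \<longrightarrow> x \<in> X))"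

text \<open>Exchanging the two runs exchanges the sides, so one step lemma serves deadlines on
  either side.\<close>

lemma dominated_swap: "dominated s X Y \<longleftrightarrow> dominated (\<not> s) Y X"
  by (auto simp: dominated_def)

text \<open>The candidates of \<open>x\<close> lie on the opposite side, so the run at
  \<open>X\<close> offers a subset of those offered at \<open>Y\<close>. The minimum over the larger
  set is either already matched in \<open>X\<close> or also the minimum over the smaller
  set.\<close>

lemma dominated_step_same_side:
  assumes "inj_on y V" "dominated (side x) X Y"
  shows "dominated (side x) (step E y x X) (step E y x Y)"
proof -
  have sub: "avail E x X \<subseteq> avail E x Y"
    unfolding avail_def using assms(2) E_side unfolding dominated_def by blast
  have other: "side p \<noteq> side x" if "p \<in> avail E x Z" for p Z
    using that E_side by (auto simp: avail_def)
  consider "x \<in> Y" | "x \<notin> Y" "avail E x Y = {}" | "x \<notin> Y" "avail E x Y \<noteq> {}" by blast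
  then show ?thesis
  proof cases
    \<comment> \<open>If the run at \<open>X\<close> matches \<open>x\<close> now, it adds a vertex
      that \<open>Y\<close> already contains and a partner on the side where \<open>X\<close> may
      exceed \<open>Y\<close>.\<close>
    case 1
    then show ?thesis using assms(2) other[OF pick_in[of x X y]]
      by (auto simp: step_def dominated_def)
  next
    case 2
    then show ?thesis using assms(2) sub by (auto simp: step_def)
  next
    case 3
    let ?p = "pick E y x Y"
    have p: "?p \<in> avail E x Y" by (rule pick_in[OF 3(2)])
    have x: "x \<notin> X" using 3(1) assms(2) by (auto simp: dominated_def)
    have "?p \<in> step E y x X"
    proof (cases "?p \<in> X")
      case True
      then show ?thesis using step_mono[of X E y x] by auto
    next
      case False
      then have q: "?p \<in> avail E x X" using p by (auto simp: avail_def)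
      have "pick E y x X = ?p" by (rule pick_eq[OF assms(1) q]) (use sub pick_le in auto)
      then show ?thesis using q x by (auto simp: step_def)
    qed
    then show ?thesis using assms(2) other[OF pick_in[of x X y]] other[OF p] x 3
      by (auto simp: step_def dominated_def)
  qed
qed

lemma dominated_run:
  assumes "inj_on y V" "dominated s X Y"
  shows "dominated s (run E y xs X) (run E y xs Y)"
  using assms(2)
proof (induction xs arbitrary: X Y)
  case (Cons x xs)
  have "dominated s (step E y x X) (step E y x Y)"
  proof (cases "side x = s")
    case True
    then show ?thesis using dominated_step_same_side[OF assms(1), of x X Y] Cons.prems by simp
  next
    case False
    then have "s = (\<not> side x)" by auto
    then show ?thesis using dominated_step_same_side[OF assms(1), of x Y X] Cons.prems
        dominated_swap[of "\<not> side x"] by simp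
  qed
  then show ?case using Cons.IH by simp
qed simp

text \<open>Deletion means starting with \<open>v\<close> already matched; by
  \<open>dominated\<close>, the vertices opposite to \<open>v\<close> that are then matched are also
  matched with \<open>v\<close> present.\<close>

lemma run_remove_opposite:
  assumes "inj_on y V" "side u \<noteq> side v" "u \<in> run E y xs (insert v X)"
  shows "u \<in> run E y xs X"
proof -
  have "dominated (side u) (insert v X) X" using assms(2) by (auto simp: dominated_def)
  from dominated_run[OF assms(1) this, of xs] assms(3) show ?thesis by (auto simp: dominated_def)
qed

text \<open>On its own side the deletion of \<open>v\<close> removes a competitor, so whatever was
  matched stays matched.\<close>

lemma run_remove_same_side:
  assumes "inj_on y V" "side p = side v" "p \<in> run E y xs X"
  shows "p \<in> run E y xs (insert v X)"
proof -
  have "dominated (\<not> side v) (insert v X) X" using assms(2) by (auto simp: dominated_def)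
  from dominated_run[OF assms(1) this, of xs] assms(2,3) show ?thesis by (auto simp: dominated_def)
qed

section \<open>Size of the matching\<close>

lemma match_list_in_V: "set (match_list E y xs X) \<subseteq> (set xs \<inter> V) \<times> V"
proof (induction xs arbitrary: X)
  case (Cons x xs)
  have "x \<in> V \<and> pick E y x X \<in> V" if "avail E x X \<noteq> {}"
    using pick_in[OF that, of y] E_V E_sym by (auto simp: avail_def)
  then show ?case using Cons[of X] Cons[of "step E y x X"] by auto
qed simp

lemma card_ranking_run:
  assumes "finite M"
  shows "card (ranking_run E y es M) = card M + length (match_list E y (deadlines es) (\<Union>M))
       \<and> finite (ranking_run E y es M)"
  using assms
proof (induction es arbitrary: M rule: deadlines.induct)
  case (3 v es)
  define D where "D = ranking_deadline E y v M"
  show ?case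
  proof (cases "v \<in> \<Union>M \<or> avail E v (\<Union>M) = {}")
    case True
    then have "D = M" by (auto simp: D_def ranking_deadline_def avail_def Let_def)
    then show ?thesis using 3 True by (auto simp: D_def)
  next
    case False
    then have D: "D = insert {pick E y v (\<Union>M), v} M"
      by (auto simp: D_def ranking_deadline_def avail_def pick_def Let_def)
    \<comment> \<open>\<open>v\<close> is not covered by \<open>M\<close>, so the new edge differs
      from all earlier ones and the cardinality grows by one.\<close>
    have "{pick E y v (\<Union>M), v} \<notin> M" using False by auto
    then have "card D = Suc (card M)" "finite D" using D 3(2) by auto
    moreover have "\<Union>D = step E y v (\<Union>M)" using False by (auto simp: D step_def)
    ultimately show ?thesis using 3(1)[of D] False by (simp add: D_def[symmetric])
  qed
qed auto

end

section \<open>Gain sharing\<close>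

text \<open>Intermediate values give a solution in the unit interval, strict growth of
  \<open>w * exp w\<close> for positive \<open>w\<close> gives uniqueness. The logarithmic form is
  the one met when prices are integrated.\<close>

lemma omega_const: "0 < omega_const" "omega_const < 1" "ln omega_const = - omega_const"
proof -
  have "\<exists>w\<ge>0. w \<le> 1 \<and> w * exp w = (1::real)"
    using exp_ge_add_one_self[of 1] by (intro IVT') (auto intro!: continuous_intros)
  then obtain w :: real where w: "0 \<le> w" "w \<le> 1" "w * exp w = 1" by blast
  have unique: "w' = w" if w': "w' * exp w' = 1" for w' :: real
  proof -
    have "0 < w'" using w' by (metis exp_gt_zero zero_less_mult_pos2 zero_less_one)
    have "\<not> w' < w" "\<not> w < w'"
      using mult_strict_mono[of w' w "exp w'" "exp w"] mult_strict_mono[of w w' "exp w" "exp w'"]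
        w w' \<open>0 < w'\<close> by auto
    then show ?thesis by simp
  qed
  have "omega_const = w" unfolding omega_const_def using w(3) unique by (rule the_equality)
  moreover have "w \<noteq> 0" using w(3) by auto
  moreover have "w \<noteq> 1" using w(3) exp_ge_add_one_self[of 1] by auto
  moreover have "ln (w * exp w) = 0" using w(3) by simp
  then have "ln w + w = 0" using \<open>w \<noteq> 0\<close> w(1) by (simp add: ln_mult)
  ultimately show "0 < omega_const" "omega_const < 1" "ln omega_const = - omega_const"
    using w by auto
qed

text \<open>\<open>(1 - t) * price t\<close> is constant until \<open>price t\<close> reaches the cap \<open>1 - price 0\<close>.\<close>
definition price :: "real \<Rightarrow> real" where
  "price t = (if t \<le> 1 - omega_const then omega_const / ((1 + omega_const) * (1 - t))
     else 1 / (1 + omega_const))"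

lemma price_le: "price t \<le> 1 / (1 + omega_const)"
  using omega_const by (auto simp: price_def divide_simps)

lemma price_nonneg: "0 \<le> price t"
  using omega_const by (auto simp: price_def)

lemma price_le_1: "price t \<le> 1"
proof -
  have "1 / (1 + omega_const) \<le> 1" using omega_const by simp
  then show ?thesis using price_le[of t] by linarith
qed

lemma price_mono: "s \<le> t \<Longrightarrow> price s \<le> price t"
  using omega_const price_le[of s] by (auto simp: price_def intro!: divide_left_mono mult_left_mono)

lemma price_ge: "0 \<le> t \<Longrightarrow> omega_const / (1 + omega_const) \<le> price t"
  using price_mono[of 0 t] omega_const by (simp add: price_def)

text \<open>Equality holds up to \<open>1 - omega_const\<close>; beyond it the price is capped while
  \<open>1 - t\<close> is below \<open>omega_const\<close>.\<close>

lemma one_minus_mult_price_le: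
  "t \<le> 1 \<Longrightarrow> (1 - t) * price t \<le> omega_const / (1 + omega_const)"
  using omega_const by (auto simp: price_def divide_simps)

text \<open>As a sum over all pairs with nonnegative shares, it is bounded below by the share in any
  single pair, and its total over \<open>V\<close> can be computed pair by pair.\<close>

definition gain :: "('a \<Rightarrow> 'a \<Rightarrow> bool) \<Rightarrow> 'a list \<Rightarrow> ('a \<Rightarrow> real) \<Rightarrow> 'a \<Rightarrow> real" where
  "gain E xs y x = (\<Sum>(s, t)\<leftarrow>match_list E y xs {}.
     (if t = x then price (y t) else 0) + (if s = x then 1 - price (y t) else 0))"

lemma gain_nonneg: "0 \<le> gain E xs y x"
  unfolding gain_def by (intro sum_list_nonneg) (auto simp: price_nonneg price_le_1)

lemma gain_ge_member:
  assumes "(s, t) \<in> set (match_list E y xs {})"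
  shows "(if t = x then price (y t) else 0) + (if s = x then 1 - price (y t) else 0) \<le> gain E xs y x"
proof -
  let ?f = "\<lambda>(s, t). (if t = x then price (y t) else 0) + (if s = x then 1 - price (y t) else 0)"
  have "?f (s, t) \<in> set (map ?f (match_list E y xs {}))"
    unfolding set_map using assms by (rule imageI)
  then have "?f (s, t) \<le> gain E xs y x"
    unfolding gain_def by (rule member_le_sum_list) (auto simp: price_nonneg price_le_1)
  then show ?thesis by simp
qed

lemma passive_gain:
  assumes "(s, x) \<in> set (match_list E y xs {})"
  shows "price (y x) \<le> gain E xs y x"
proof -
  have "0 \<le> (if s = x then 1 - price (y x) else 0)" by (auto simp: price_le_1)
  then show ?thesis using gain_ge_member[OF assms, of x] by simp
qed

lemma active_gain:
  assumes "(x, t) \<in> set (match_list E y xs {})"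
  shows "1 - price (y t) \<le> gain E xs y x"
proof -
  have "0 \<le> (if t = x then price (y t) else 0)" by (auto simp: price_nonneg)
  then show ?thesis using gain_ge_member[OF assms, of x] by simp
qed

context bipartite_graph
begin

text \<open>The passive and the active share of each pair add up to 1.\<close>

lemma sum_gain: "(\<Sum>x\<in>V. gain E xs y x) = real (length (match_list E y xs {}))"
proof -
  have "(\<Sum>x\<in>V. \<Sum>(s, t)\<leftarrow>l. (if t = x then price (y t) else 0) + (if s = x then 1 - price (y t) else 0))
      = real (length l)" if "set l \<subseteq> V \<times> V" for l
    using that
  proof (induction l)
    case (Cons a l)
    obtain s t where "a = (s, t)" by fastforce
    then show ?case using Cons finite_V by (simp add: sum.distrib)
  qed simp
  moreover have "set (match_list E y xs {}) \<subseteq> V \<times> V" using match_list_in_V[of y xs "{}"] by auto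
  ultimately show ?thesis unfolding gain_def by blast
qed

lemma card_ranking: "real (card (ranking E es y)) = (\<Sum>x\<in>V. gain E (deadlines es) y x)"
  using card_ranking_run[of "{}" y es] by (simp add: ranking_def sum_gain)

section \<open>Gains of the endpoints of one edge at fixed ranks\<close>

context
  fixes y :: "'a \<Rightarrow> real" and xs zs :: "'a list" and u v :: 'a
  assumes inj: "inj_on y V" and edge: "E u v" and u: "u \<notin> set xs" and v: "v \<notin> set xs"
begin

lemma edge_sides: "side u \<noteq> side v" "u \<noteq> v"
  using edge E_side by auto

lemma passive_gain_before:
  assumes "w \<in> run E y xs {}" "w \<notin> set xs"
  shows "price (y w) \<le> gain E (xs @ u # zs) y w"
proof -
  obtain s where "(s, w) \<in> set (match_list E y xs {})"
    using passive_in_match_list[OF assms(1) _ assms(2)] by auto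
  then show ?thesis by (intro passive_gain[of s]) (auto simp: match_list_append)
qed

lemma gain_first_passive:
  assumes "u \<in> run E y xs {v}"
  shows "price (y u) \<le> gain E (xs @ u # zs) y u"
  using run_remove_opposite[OF inj edge_sides(1) assms] u by (rule passive_gain_before)

lemma gain_second_passive:
  assumes "v \<in> run E y xs {u}"
  shows "price (y v) \<le> gain E (xs @ u # zs) y v"
  using run_remove_opposite[OF inj edge_sides(1)[symmetric] assms] v by (rule passive_gain_before)

lemma match_list_active:
  assumes "u \<notin> run E y xs {}" "p \<in> avail E u (run E y xs {})"
  shows "(u, pick E y u (run E y xs {})) \<in> set (match_list E y (xs @ u # zs) {})"
  using assms by (auto simp: match_list_append)

lemma gain_active:
  assumes "u \<notin> run E y xs {}" "p \<in> avail E u (run E y xs {})"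
  shows "1 - price (y p) \<le> gain E (xs @ u # zs) y u"
  using active_gain[OF match_list_active[OF assms]] price_mono[OF pick_le[OF assms(2), of y]] by simp

text \<open>With \<open>v\<close> deleted, \<open>u\<close> stays unmatched, so deleting
  \<open>u\<close> as well changes nothing else. Restoring \<open>v\<close> can only free vertices
  on the side of \<open>v\<close>, where the neighbours of \<open>u\<close> lie.\<close>

lemma avail_run_both:
  assumes "u \<notin> run E y xs {v}"
  shows "avail E u (run E y xs {u, v}) \<subseteq> avail E u (run E y xs {})"
proof -
  have eq: "run E y xs {u, v} = insert u (run E y xs {v})" by (rule run_insert[OF inj assms u])
  have "p \<notin> run E y xs {}" if "p \<in> avail E u (run E y xs {u, v})" for p
  proof
    assume "p \<in> run E y xs {}"
    moreover have "E p u" using that by (auto simp: avail_def)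
    then have "side p = side v" using E_side[of p u] edge_sides by auto
    ultimately have "p \<in> run E y xs {v}" using run_remove_same_side[OF inj] by blast
    then show False using that unfolding eq by (auto simp: avail_def)
  qed
  then show ?thesis by (auto simp: avail_def)
qed

text \<open>The presence of \<open>v\<close> may turn \<open>u\<close> passive; otherwise
  \<open>p\<close> is still available at the deadline of \<open>u\<close>, whose choice is then at
  least as cheap.\<close>

lemma gain_first_not_passive:
  assumes "u \<notin> run E y xs {v}" "p \<in> avail E u (run E y xs {u, v})"
  shows "min (price (y u)) (1 - price (y p)) \<le> gain E (xs @ u # zs) y u"
proof (cases "u \<in> run E y xs {}")
  case True
  then show ?thesis using passive_gain_before[OF _ u] by (simp add: min.coboundedI1)
next
  case False
  then show ?thesis using gain_active[OF False] avail_run_both[OF assms(1)] assms(2)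
    by (auto simp: min.coboundedI2)
qed

lemma neither_passive:
  assumes "u \<notin> run E y xs {v}" "v \<notin> run E y xs {u}"
  shows "u \<notin> run E y xs {}" "v \<notin> run E y xs {}"
  using run_two_unmatched[OF inj assms u v] edge_sides by auto

lemma gain_first_active:
  assumes "u \<notin> run E y xs {v}" "v \<notin> run E y xs {u}" "p \<in> avail E u (run E y xs {u, v})"
  shows "1 - price (y p) \<le> gain E (xs @ u # zs) y u"
  using gain_active[OF neither_passive(1)[OF assms(1,2)]] avail_run_both[OF assms(1)] assms(3) by blast

text \<open>Both endpoints reach the deadline of \<open>u\<close> unmatched, and \<open>v\<close>
  beats every rival, so \<open>u\<close> takes \<open>v\<close> and the two shares of this pair add
  up to 1.\<close>

lemma gain_edge_matched:
  assumes "u \<notin> run E y xs {v}" "v \<notin> run E y xs {u}"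
    "\<And>p. p \<in> avail E u (run E y xs {u, v}) \<Longrightarrow> y v \<le> y p"
  shows "1 \<le> gain E (xs @ u # zs) y u + gain E (xs @ u # zs) y v"
proof -
  let ?S = "run E y xs {}"
  have "run E y xs {v} = insert v ?S" by (rule run_insert[OF inj neither_passive(2)[OF assms(1,2)] v])
  then have "run E y xs {u, v} = insert u (insert v ?S)"
    using run_insert[OF inj assms(1) u] by simp
  then have eq: "avail E u (run E y xs {u, v}) = avail E u ?S - {u, v}" by (auto simp: avail_def)
  have "u \<notin> avail E u ?S" using E_side[of u u] by (auto simp: avail_def)
  then have min: "y v \<le> y p" if "p \<in> avail E u ?S" for p
    using that assms(3)[of p] eq by (cases "p = v") auto
  have vS: "v \<in> avail E u ?S" using neither_passive[OF assms(1,2)] E_sym[OF edge] by (auto simp: avail_def)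
  have "pick E y u ?S = v" using inj vS min by (rule pick_eq)
  then have "(u, v) \<in> set (match_list E y (xs @ u # zs) {})"
    using match_list_active[OF neither_passive(1)[OF assms(1,2)] vS] by simp
  then show ?thesis using passive_gain active_gain by fastforce
qed

end

end

section \<open>Expected prices\<close>

abbreviation unif :: "real measure" where
  "unif \<equiv> uniform_measure lborel {0..<1}"

interpretation unif: prob_space unif
  by (rule prob_space_uniform_measure) auto

text \<open>Finite exceptional sets are null; they will contain ranks that cause ties and the
  thresholds themselves.\<close>

lemma AE_unif:
  assumes "finite A" "\<And>t. 0 \<le> t \<Longrightarrow> t < 1 \<Longrightarrow> t \<notin> A \<Longrightarrow> P t"
  shows "AE t in unif. P t"
proof -
  have "AE t in lborel. t \<notin> A"
    using assms(1) by (intro AE_not_in) (simp add: finite_imp_null_set_lborel)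
  then show ?thesis using assms(2) by (intro AE_uniform_measureI) auto
qed

lemma measure_unif_less: "0 \<le> t \<Longrightarrow> t \<le> 1 \<Longrightarrow> measure unif {..<t} = t"
proof -
  assume t: "0 \<le> t" "t \<le> 1"
  have "{0..<1} \<inter> {..<t} = {0..<t}" using t by auto
  then show ?thesis using t by simp
qed

lemma price_measurable [measurable]: "price \<in> borel_measurable borel"
  unfolding price_def by measurable

lemma integrable_unif_bounded:
  assumes "f \<in> borel_measurable borel" "\<And>t. \<bar>f t\<bar> \<le> (B::real)"
  shows "integrable unif f"
  by (rule unif.integrable_const_bound[of _ B]) (use assms in auto)

definition price_int :: "real \<Rightarrow> real" where
  "price_int t = (\<integral>s. indicator {..<t} s * price s \<partial>unif)"

lemma integrable_price:
  "integrable unif (\<lambda>s. indicator {..<t} s * price s)"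
  by (rule integrable_unif_bounded[of _ 1])
    (auto simp: indicator_def price_nonneg price_le_1)

lemma integrable_indicator_unif:
  "integrable unif (\<lambda>s. indicator {..<t} s * (c::real))"
  by (rule integrable_unif_bounded[of _ "\<bar>c\<bar>"]) (auto simp: indicator_def)

lemma integral_indicator_unif:
  "0 \<le> t \<Longrightarrow> t \<le> 1 \<Longrightarrow> (\<integral>s. indicator {..<t} s * (c::real) \<partial>unif) = t * c"
  using measure_unif_less[of t] by simp

text \<open>Passes from an explicit integrable minorant to the nonnegative integral; since
  \<open>h\<close> may be negative, its positive part is used in between.\<close>

lemma nn_integral_unif_ge:
  assumes "integrable unif h" "AE t in unif. h t \<le> f t" "c \<le> (\<integral>t. h t \<partial>unif)"
  shows "ennreal c \<le> (\<integral>\<^sup>+t. ennreal (f t) \<partial>unif)"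
proof -
  have "c \<le> (\<integral>t. max 0 (h t) \<partial>unif)"
    using assms(3) by (rule order_trans) (intro integral_mono, use assms(1) in auto)
  then have "ennreal c \<le> ennreal (\<integral>t. max 0 (h t) \<partial>unif)" by (rule ennreal_leI)
  also have "\<dots> = (\<integral>\<^sup>+t. ennreal (max 0 (h t)) \<partial>unif)"
    using assms(1) by (intro nn_integral_eq_integral[symmetric]) auto
  also have "\<dots> \<le> (\<integral>\<^sup>+t. ennreal (f t) \<partial>unif)"
    using assms(2) by (intro nn_integral_mono_AE) (auto simp: ennreal_leI max_def)
  finally show ?thesis .
qed

lemma price_int_eq:
  assumes "0 \<le> t" "t \<le> 1 - omega_const"
  shows "price_int t = - (omega_const / (1 + omega_const)) * ln (1 - t)"
proof -
  note w = omega_const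
  let ?k = "omega_const / (1 + omega_const)"
  have "price_int t = (\<integral>s. indicator {0..<1} s * (indicator {..<t} s * price s) \<partial>lborel)"
    unfolding price_int_def uniform_measure_def
    by (subst integral_real_density[symmetric])
      (auto intro!: Bochner_Integration.integral_cong arg_cong2[where f = density] simp: fun_eq_iff indicator_def)
  also have "\<dots> = (\<integral>s. price s * indicator {0..t} s \<partial>lborel)"
  proof (rule integral_cong_AE)
    \<comment> \<open>The half-open and the closed interval differ only at the null point
      \<open>t\<close>.\<close>
    show "AE s in lborel. indicator {0..<1} s * (indicator {..<t} s * price s) = price s * indicator {0..t} s"
      using AE_lborel_singleton[of t] by eventually_elim (use assms w in \<open>auto simp: indicator_def\<close>)
  qed auto
  also have "\<dots> = (\<integral>s. ?k / (1 - s) * indicator {0..t} s \<partial>lborel)"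
    using assms by (intro Bochner_Integration.integral_cong) (auto simp: indicator_def price_def)
  also have "\<dots> = - ?k * ln (1 - t) - (- ?k * ln (1 - 0))"
    using assms w
    by (intro integral_FTC_Icc_real) (auto intro!: derivative_eq_intros continuous_intros)
  finally show ?thesis by simp
qed

text \<open>The relation \<open>ln omega_const = - omega_const\<close> gives the value at
  \<open>1 - omega_const\<close>; from there on the price is constant and its integral linear in
  \<open>t\<close>.\<close>

lemma price_int_ge:
  assumes "1 - omega_const \<le> t" "t \<le> 1"
  shows "omega_const\<^sup>2 / (1 + omega_const) + (t - (1 - omega_const)) / (1 + omega_const) \<le> price_int t"
proof -
  note w = omega_const
  let ?p = "1 - omega_const" and ?a = "1 / (1 + omega_const)"
  have "price_int ?p = omega_const\<^sup>2 / (1 + omega_const)"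
    using price_int_eq[of ?p] w by (simp add: power2_eq_square)
  moreover have "(\<integral>s. indicator {..<t} s * ?a - indicator {..<?p} s * ?a \<partial>unif) = t * ?a - ?p * ?a"
    using assms w integral_indicator_unif[of t ?a] integral_indicator_unif[of ?p ?a] integrable_indicator_unif
    by (subst Bochner_Integration.integral_diff) auto
  moreover have "price_int ?p + (\<integral>s. indicator {..<t} s * ?a - indicator {..<?p} s * ?a \<partial>unif)
      = (\<integral>s. indicator {..<?p} s * price s + (indicator {..<t} s * ?a - indicator {..<?p} s * ?a) \<partial>unif)"
    unfolding price_int_def
    by (rule Bochner_Integration.integral_add[symmetric])
       (intro integrable_price Bochner_Integration.integrable_diff integrable_indicator_unif)+
  moreover have "\<dots> \<le> price_int t"
    unfolding price_int_def
  proof (rule integral_mono)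
    fix s
    have "price s = ?a" if "?p \<le> s" using that w by (auto simp: price_def divide_simps)
    then show "indicator {..<?p} s * price s + (indicator {..<t} s * ?a - indicator {..<?p} s * ?a)
      \<le> indicator {..<t} s * price s"
      using assms by (cases "s < ?p") (auto simp: indicator_def)
  qed (intro integrable_price Bochner_Integration.integrable_add Bochner_Integration.integrable_diff integrable_indicator_unif)+
  ultimately show ?thesis by (simp add: diff_divide_distrib)
qed

text \<open>Let the second endpoint of an edge be passive below rank \<open>\<tau>\<close> if the first one is deleted. Then
  \<open>price_int \<tau>\<close> is its gain below \<open>\<tau>\<close>, and the smaller one of \<open>cap \<tau>\<close> and the price of the first
  endpoint is gained in addition. For \<open>\<tau> \<le> 1 - omega_const\<close> the bound in \<open>price_int_cap\<close> below is an
  equality, which determines the price function.\<close>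
definition cap :: "real \<Rightarrow> real" where
  "cap \<tau> = (if \<tau> \<le> 1 - omega_const then (1 - \<tau>) / (1 + omega_const)
     else min (omega_const / (1 + omega_const)) (1 - \<tau>))"

lemma price_int_cap:
  assumes "0 \<le> \<tau>" "\<tau> \<le> 1"
  shows "omega_const \<le> (\<integral>s. price_int \<tau> + min (price s) (cap \<tau>) \<partial>unif)"
proof -
  note w = omega_const
  let ?k = "omega_const / (1 + omega_const)" and ?a = "1 / (1 + omega_const)"
  have cap: "0 \<le> cap \<tau>" using w assms by (auto simp: cap_def)
  have int: "integrable unif (\<lambda>s. min (price s) (cap \<tau>))"
    using cap price_nonneg price_le_1
    by (intro integrable_unif_bounded[of _ 1]) (auto simp: min_le_iff_disj abs_of_nonneg)
  then have eq: "(\<integral>s. price_int \<tau> + min (price s) (cap \<tau>) \<partial>unif)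
      = price_int \<tau> + (\<integral>s. min (price s) (cap \<tau>) \<partial>unif)"
    by (subst Bochner_Integration.integral_add) (auto simp: unif.prob_space)
  show ?thesis
  proof (cases "\<tau> \<le> 1 - omega_const")
    case True
    \<comment> \<open>\<open>q\<close> is the rank at which the price reaches
      \<open>cap \<tau>\<close>, so the minimum is the price below \<open>q\<close> and
      \<open>cap \<tau>\<close> above.\<close>
    define q where "q = 1 - omega_const / (1 - \<tau>)"
    have tau: "0 < 1 - \<tau>" using True w by simp
    have "0 \<le> omega_const * \<tau>" using w assms by simp
    then have q: "0 \<le> q" "q \<le> 1 - omega_const" using True tau
      by (auto simp: q_def divide_simps algebra_simps)
    have "price_int q + (1 - q) * cap \<tau> = (\<integral>s. indicator {..<q} s * price s \<partial>unif)
        + (\<integral>s. cap \<tau> - indicator {..<q} s * cap \<tau> \<partial>unif)"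
      using q w integral_indicator_unif[of q "cap \<tau>"] integrable_indicator_unif[of q "cap \<tau>"]
      by (subst Bochner_Integration.integral_diff) (auto simp: unif.prob_space price_int_def algebra_simps)
    also have "\<dots> = (\<integral>s. indicator {..<q} s * price s + (cap \<tau> - indicator {..<q} s * cap \<tau>) \<partial>unif)"
      by (rule Bochner_Integration.integral_add[symmetric])
        (intro integrable_price Bochner_Integration.integrable_diff integrable_indicator_unif
          unif.integrable_const)+
    also have "\<dots> \<le> (\<integral>s. min (price s) (cap \<tau>) \<partial>unif)"
    proof (rule integral_mono[OF _ int])
      fix s
      have q_price: "price q = cap \<tau>"
        using q w tau True by (simp add: price_def cap_def q_def)
      show "indicator {..<q} s * price s + (cap \<tau> - indicator {..<q} s * cap \<tau>) \<le> min (price s) (cap \<tau>)"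
        using price_mono[of s q] price_mono[of q s] q_price by (cases "s < q") (auto simp: indicator_def)
    qed (intro integrable_price Bochner_Integration.integrable_add Bochner_Integration.integrable_diff
        integrable_indicator_unif unif.integrable_const)
    finally have "price_int q + ?k \<le> (\<integral>s. min (price s) (cap \<tau>) \<partial>unif)"
      using tau True by (simp add: q_def cap_def)
    \<comment> \<open>By the choice of \<open>q\<close>,
      \<open>(1 - q) * (1 - \<tau>) = omega_const\<close>: the logarithms add up to a value
      independent of \<open>\<tau>\<close>.\<close>
    moreover have ln: "ln (1 - q) + ln (1 - \<tau>) = - omega_const"
      using w tau by (simp add: q_def ln_div)
    have "price_int q + price_int \<tau> = - ?k * (ln (1 - q) + ln (1 - \<tau>))"
      unfolding price_int_eq[OF q] price_int_eq[OF assms(1) True] by (rule distrib_left[symmetric])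
    then have "price_int q + price_int \<tau> + ?k = ?k * (1 + omega_const)"
      unfolding ln by (simp add: distrib_left)
    moreover have "?k * (1 + omega_const) = omega_const" using w by simp
    ultimately show ?thesis using eq by simp
  next
    case False
    \<comment> \<open>Here \<open>cap \<tau>\<close> is at most \<open>price 0\<close>, so the
      minimum is \<open>cap \<tau>\<close> at every nonnegative rank.\<close>
    have "cap \<tau> = (\<integral>s. cap \<tau> \<partial>unif)" by (simp add: unif.prob_space)
    also have "\<dots> \<le> (\<integral>s. min (price s) (cap \<tau>) \<partial>unif)"
    proof (rule integral_mono_AE[OF _ int])
      show "AE s in unif. cap \<tau> \<le> min (price s) (cap \<tau>)"
      proof (rule AE_unif[of "{}"])
        fix s :: real assume "0 \<le> s"
        then show "cap \<tau> \<le> min (price s) (cap \<tau>)" using False price_ge[of s] by (auto simp: cap_def)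
      qed simp
    qed simp
    finally have "price_int \<tau> + cap \<tau> \<le> (\<integral>s. price_int \<tau> + min (price s) (cap \<tau>) \<partial>unif)"
      using eq by simp
    moreover have "omega_const \<le> price_int \<tau> + cap \<tau>"
    proof -
      have ge: "omega_const\<^sup>2 / (1 + omega_const) + (\<tau> - (1 - omega_const)) / (1 + omega_const) \<le> price_int \<tau>"
        using price_int_ge[of \<tau>] False assms by simp
      have a: "?a * (1 + omega_const) = 1" using w by simp
      then have "omega_const\<^sup>2 * ?a + omega_const * ?a = omega_const" by algebra
      then have "omega_const\<^sup>2 / (1 + omega_const) + ?k = omega_const" by simp
      moreover have "0 \<le> (\<tau> - (1 - omega_const)) / (1 + omega_const)" using False w by simp
      \<comment> \<open>This settles the alternative \<open>1 - \<tau>\<close> in the definition of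
        \<open>cap\<close>, with surplus
        \<open>omega_const * (1 - \<tau>) / (1 + omega_const)\<close>; the other alternative follows
        from the two facts before.\<close>
      moreover have "omega_const \<le> omega_const\<^sup>2 / (1 + omega_const)
          + (\<tau> - (1 - omega_const)) / (1 + omega_const) + (1 - \<tau>)"
      proof -
        from a have "omega_const\<^sup>2 * ?a + (\<tau> - (1 - omega_const)) * ?a + (1 - \<tau>) - omega_const
          = omega_const * (1 - \<tau>) * ?a" by algebra
        moreover have "0 \<le> omega_const * (1 - \<tau>) / (1 + omega_const)" using w assms by simp
        ultimately show ?thesis unfolding times_divide_eq_right mult_1_right by linarith
      qed
      ultimately show ?thesis using ge False by (auto simp: cap_def min_def)
    qed
    ultimately show ?thesis by simp
  qed
qed

lemma cap_le: "0 \<le> \<tau> \<Longrightarrow> \<tau> \<le> 1 \<Longrightarrow> cap \<tau> \<le> 1 - \<tau>"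
  using omega_const by (auto simp: cap_def divide_simps mult_left_le)

text \<open>Ranks of the second endpoint below \<open>\<tau>\<close>, between \<open>\<tau>\<close> and \<open>\<beta>\<close>, and above \<open>\<beta>\<close> contribute
  the three summands on the right.\<close>
lemma cap_le_step:
  assumes "0 \<le> \<tau>" "\<tau> \<le> \<beta>" "\<beta> \<le> 1"
  shows "min x (cap \<tau>) \<le> \<tau> * min x (1 - price \<beta>) + (\<beta> - \<tau>) + (1 - \<beta>) * (1 - price \<beta>)"
proof -
  note w = omega_const
  have pb: "(1 - \<beta>) * price \<beta> \<le> omega_const / (1 + omega_const)"
    by (rule one_minus_mult_price_le[OF assms(3)])
  have expand: "(\<beta> - \<tau>) + (1 - \<beta>) * (1 - price \<beta>) = 1 - \<tau> - (1 - \<beta>) * price \<beta>"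
    by (simp add: algebra_simps)
  show ?thesis
  proof (cases "x \<le> 1 - price \<beta>")
    case True
    have "(1 - \<beta>) * price \<beta> \<le> (1 - \<tau>) * (1 - x)"
      using True assms price_nonneg[of \<beta>] by (intro mult_mono) auto
    then have "x \<le> \<tau> * x + (1 - \<tau> - (1 - \<beta>) * price \<beta>)" by (simp add: algebra_simps)
    then show ?thesis using True expand by (simp add: min_def)
  next
    case False
    \<comment> \<open>In this case the right-hand side of the claim collapses to
      \<open>1 - (1 - \<beta> + \<tau>) * price \<beta>\<close>.\<close>
    have "cap \<tau> \<le> 1 - (1 - \<beta> + \<tau>) * price \<beta>"
    proof (cases "\<tau> \<le> 1 - omega_const")
      case True
      have "\<tau> * price \<beta> \<le> \<tau> * (1 / (1 + omega_const))"
        using assms price_le by (intro mult_left_mono)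
      moreover have "1 - omega_const / (1 + omega_const) - \<tau> * (1 / (1 + omega_const)) = (1 - \<tau>) / (1 + omega_const)"
        using w by (simp add: field_simps)
      ultimately show ?thesis using pb True by (simp add: cap_def algebra_simps)
    next
      case False
      have "(1 - \<beta> + \<tau>) * price \<beta> \<le> 1 * (1 / (1 + omega_const))"
        using assms price_le price_nonneg by (intro mult_mono) auto
      moreover have "1 - 1 / (1 + omega_const) = omega_const / (1 + omega_const)"
        using w by (simp add: field_simps)
      ultimately show ?thesis using False by (simp add: cap_def min_def)
    qed
    then show ?thesis using False expand by (simp add: min_def algebra_simps)
  qed
qed

section \<open>Random ranks\<close>

lemma inj_on_two_updates:
  fixes z :: "'a \<Rightarrow> real"
  assumes "inj_on z (V - {u, v})" "s \<notin> z ` (V - {u, v})" "t \<notin> z ` (V - {u, v})" "s \<noteq> t"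
  shows "inj_on (z(u := s, v := t)) V"
proof (rule inj_onI)
  fix p q assume pq: "p \<in> V" "q \<in> V" "(z(u := s, v := t)) p = (z(u := s, v := t)) q"
  have "z w \<noteq> s" "z w \<noteq> t" if "w \<in> V" "w \<noteq> u" "w \<noteq> v" for w
    using that assms(2,3) by auto
  then show "p = q" using pq assms(4) inj_onD[OF assms(1), of p q]
    by (cases "p = u"; cases "p = v"; cases "q = u"; cases "q = v") force+
qed

text \<open>Order-equivalent ranks have the same predicate \<open>is_arg_min\<close>, so the choice
  made from it is the same even if there are ties.\<close>

lemma arg_min_on_cong:
  assumes "\<And>a b. a \<in> S \<Longrightarrow> b \<in> S \<Longrightarrow> (y a < y b) = (y' a < y' b)"
  shows "arg_min_on y S = arg_min_on y' S"
proof -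
  have "is_arg_min y (\<lambda>x. x \<in> S) = is_arg_min y' (\<lambda>x. x \<in> S)"
    using assms by (auto simp: is_arg_min_def fun_eq_iff)
  then show ?thesis by (simp add: arg_min_on_def arg_min_def)
qed

interpretation unif_prod: product_sigma_finite "\<lambda>_. unif"
  by unfold_locales

lemma prob_space_unif_prod: "prob_space (PiM V (\<lambda>_. unif))"
  by (intro prob_space_PiM unif.prob_space_axioms)

text \<open>With the other coordinates fixed, a tie forces coordinate \<open>a\<close> to take a
  single value; Fubini makes this null.\<close>

lemma AE_unif_prod_neq:
  assumes "finite V" "a \<in> V" "b \<in> V" "a \<noteq> b"
  shows "AE y in PiM V (\<lambda>_. unif). y a \<noteq> y b"
proof -
  let ?J = "V - {a}"
  have V: "V = insert a ?J" using assms by auto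
  let ?f = "\<lambda>y. indicator {0} (y a - y b) :: ennreal"
  have meas: "?f \<in> borel_measurable (PiM V (\<lambda>_. unif))" using assms by measurable
  then have "?f \<in> borel_measurable (PiM (insert a ?J) (\<lambda>_. unif))" using V by simp
  then have "(\<integral>\<^sup>+y. ?f y \<partial>PiM (insert a ?J) (\<lambda>_. unif))
      = (\<integral>\<^sup>+y. (\<integral>\<^sup>+t. ?f (y(a := t)) \<partial>unif) \<partial>PiM ?J (\<lambda>_. unif))"
    by (rule unif_prod.product_nn_integral_insert[rotated 2]) (use assms(1) in auto)
  then have "(\<integral>\<^sup>+y. ?f y \<partial>PiM V (\<lambda>_. unif))
      = (\<integral>\<^sup>+y. (\<integral>\<^sup>+t. ?f (y(a := t)) \<partial>unif) \<partial>PiM ?J (\<lambda>_. unif))"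
    using V by simp
  also have "\<dots> = (\<integral>\<^sup>+y. 0 \<partial>PiM ?J (\<lambda>_. unif))"
  proof (rule nn_integral_cong)
    fix y :: "'a \<Rightarrow> real"
    have "AE t in unif. ?f (y(a := t)) = 0"
      by (rule AE_unif[of "{y b}"]) (use assms in auto)
    then have "(\<integral>\<^sup>+t. ?f (y(a := t)) \<partial>unif) = (\<integral>\<^sup>+t. 0 \<partial>unif)" by (rule nn_integral_cong_AE)
    then show "(\<integral>\<^sup>+t. ?f (y(a := t)) \<partial>unif) = 0" by simp
  qed
  finally have "(\<integral>\<^sup>+y. ?f y \<partial>PiM V (\<lambda>_. unif)) = 0" by simp
  then have "AE y in PiM V (\<lambda>_. unif). ?f y = 0"
    using nn_integral_0_iff_AE[OF meas] by simp
  then show ?thesis by eventually_elim (auto simp: indicator_def split: if_splits)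
qed

lemma AE_unif_prod:
  assumes "finite V"
  shows "AE y in PiM V (\<lambda>_. unif). inj_on y V \<and> y ` V \<subseteq> {0..<1}"
proof -
  have "AE y in PiM V (\<lambda>_. unif). \<forall>a\<in>V. \<forall>b\<in>V. a \<noteq> b \<longrightarrow> y a \<noteq> y b"
    using assms AE_unif_prod_neq[OF assms] by (intro eventually_ball_finite ballI) (auto intro: AE_impI)
  moreover have "AE y in PiM V (\<lambda>_. unif). \<forall>a\<in>V. y a \<in> {0..<1}"
    using assms AE_unif[of "{}" "\<lambda>t. t \<in> {0..<1}"]
    by (intro eventually_ball_finite ballI AE_PiM_component unif.prob_space_axioms) auto
  ultimately show ?thesis by eventually_elim (auto simp: inj_on_def)
qed

context bipartite_graph
begin

lemma match_list_cong:
  assumes "\<And>a b. a \<in> V \<Longrightarrow> b \<in> V \<Longrightarrow> (y a < y b) = (y' a < y' b)"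
  shows "match_list E y xs X = match_list E y' xs X"
proof -
  have "pick E y x X = pick E y' x X" for x X
    unfolding pick_def using assms avail_subset by (intro arg_min_on_cong) blast
  then show ?thesis by (induction xs arbitrary: X) (auto simp: step_def)
qed

text \<open>The list of pairs depends only on the finite comparison pattern \<open>r y\<close>. For
  each fixed list the gain is a measurable function of finitely many coordinates.\<close>

lemma gain_measurable [measurable]:
  "(\<lambda>y. gain E xs y x) \<in> borel_measurable (PiM V (\<lambda>_. unif))"
proof -
  let ?M = "PiM V (\<lambda>_. unif)"
  define r where "r y = {p \<in> V \<times> V. y (fst p) < y (snd p)}" for y :: "'a \<Rightarrow> real"
  \<comment> \<open>Any ranks with pattern \<open>a\<close> will do, by
    \<open>match_list_cong\<close>.\<close>
  define F where "F a = match_list E (SOME y. r y = a) xs {}" for a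
  have F: "match_list E y xs {} = F (r y)" for y
  proof -
    have "r (SOME y'. r y' = r y) = r y" by (rule someI[of "\<lambda>y'. r y' = r y" y]) (rule refl)
    then show ?thesis unfolding F_def
      by (intro match_list_cong) (auto simp: r_def set_eq_iff)
  qed
  have r: "r \<in> measurable ?M (count_space (Pow (V \<times> V)))"
  proof (subst measurable_count_space_eq2)
    show "finite (Pow (V \<times> V))" using finite_V by simp
    have "r -` {a} \<inter> space ?M \<in> sets ?M" if "a \<subseteq> V \<times> V" for a
    proof -
      have comp: "(\<lambda>y. y b) \<in> borel_measurable ?M" if "b \<in> V" for b
        using that by measurable
      have less: "{y \<in> space ?M. y (fst p) < y (snd p)} \<in> sets ?M"
        and not_less: "{y \<in> space ?M. \<not> y (fst p) < y (snd p)} \<in> sets ?M" if "p \<in> V \<times> V" for p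
        using borel_measurable_less[OF comp comp, of "fst p" "snd p"]
          borel_measurable_le[OF comp comp, of "snd p" "fst p"] that by (auto simp: not_less)
      have "(r y = a) = (\<forall>p\<in>V \<times> V. y (fst p) < y (snd p) \<longleftrightarrow> p \<in> a)" for y
        unfolding r_def using that by blast
      then have "r -` {a} \<inter> space ?M
          = {y \<in> space ?M. \<forall>p\<in>V \<times> V. y (fst p) < y (snd p) \<longleftrightarrow> p \<in> a}"
        by blast
      also have "\<dots> \<in> sets ?M"
      proof (rule sets.sets_Collect_finite_All)
        show "finite (V \<times> V)" using finite_V by simp
        show "{y \<in> space ?M. y (fst p) < y (snd p) \<longleftrightarrow> p \<in> a} \<in> sets ?M" if "p \<in> V \<times> V" for p
          using less[OF that] not_less[OF that] by (cases "p \<in> a") simp_all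
      qed
      finally show ?thesis .
    qed
    moreover have "r \<in> space ?M \<rightarrow> Pow (V \<times> V)" by (auto simp: r_def)
    ultimately show "r \<in> space ?M \<rightarrow> Pow (V \<times> V) \<and> (\<forall>a\<in>Pow (V \<times> V). r -` {a} \<inter> space ?M \<in> sets ?M)"
      by blast
  qed
  have list: "(\<lambda>y. \<Sum>(s, t)\<leftarrow>l. (if t = x then price (y t) else 0) + (if s = x then 1 - price (y t) else 0))
      \<in> borel_measurable ?M" if "set l \<subseteq> V \<times> V" for l
    using that
  proof (induction l)
    case (Cons a l)
    obtain s t where a: "a = (s, t)" by fastforce
    have "t \<in> V" using Cons(2) a by simp
    then have [measurable]: "(\<lambda>y. y t) \<in> borel_measurable ?M" by measurable
    have [measurable]: "(\<lambda>y. \<Sum>(s, t)\<leftarrow>l. (if t = x then price (y t) else 0)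
        + (if s = x then 1 - price (y t) else 0)) \<in> borel_measurable ?M"
      using Cons by auto
    show ?case unfolding a by simp
  qed simp
  show ?thesis unfolding gain_def F
  proof (rule measurable_compose_countable'[OF _ r])
    show "countable (Pow (V \<times> V))" using finite_V by (intro countable_finite) simp
    fix a
    have "set (F a) \<subseteq> V \<times> V" unfolding F_def using match_list_in_V by fastforce
    then show "(\<lambda>y. \<Sum>(s, t)\<leftarrow>F a. (if t = x then price (y t) else 0) + (if s = x then 1 - price (y t) else 0))
      \<in> borel_measurable ?M"
      by (rule list)
  qed
qed

text \<open>The threshold \<open>\<tau>\<close> does not depend on the rank of \<open>u\<close>, because it refers to the run in which
  \<open>u\<close> is deleted.\<close>
lemma second_rank_threshold:
  assumes z: "inj_on z (V - {u, v})" "z ` (V - {u, v}) \<subseteq> {0..<1}"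
    and edge: "E u v" and u: "u \<notin> set xs" and v: "v \<notin> set xs"
  obtains \<tau> where "0 \<le> \<tau>" "\<tau> \<le> 1"
    "\<And>s t. 0 \<le> s \<Longrightarrow> 0 \<le> t \<Longrightarrow> t < 1 \<Longrightarrow> inj_on (z(u := s, v := t)) V \<Longrightarrow> t < \<tau> \<Longrightarrow>
       v \<in> run E (z(u := s, v := t)) xs {u}"
    "\<And>s t. 0 \<le> s \<Longrightarrow> 0 \<le> t \<Longrightarrow> t < 1 \<Longrightarrow> inj_on (z(u := s, v := t)) V \<Longrightarrow> \<tau> < t \<Longrightarrow>
       v \<notin> run E (z(u := s, v := t)) xs {u}"
proof -
  have uv: "u \<noteq> v" using edge E_side by auto
  \<comment> \<open>The rank -1 of the deleted \<open>u\<close> is a placeholder outside the unit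
    interval, so it ties with nobody.\<close>
  define D where "D = {t. 0 \<le> t \<and> t < 1 \<and> t \<notin> z ` (V - {u, v}) \<and> v \<in> run E (z(u := -1, v := t)) xs {u}}"
  \<comment> \<open>Inserting 0 keeps the supremum meaningful when \<open>D\<close> is
    empty.\<close>
  define \<tau> where "\<tau> = Sup (insert 0 D)"
  have bdd: "bdd_above (insert 0 D)" by (rule bdd_aboveI[of _ 1]) (auto simp: D_def)
  have inj: "inj_on (z(u := -1, v := t)) V" if "0 \<le> t" "t \<notin> z ` (V - {u, v})" for t
    by (rule inj_on_two_updates[OF z(1) _ that(2)]) (use that z(2) in force)+
  have eq: "run E (z(u := s, v := t)) xs {u} = run E (z(u := -1, v := t)) xs {u}"
    and new: "t \<notin> z ` (V - {u, v})"
    if "0 \<le> t" "inj_on (z(u := s, v := t)) V" for s t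
  proof -
    show new: "t \<notin> z ` (V - {u, v})"
    proof
      assume "t \<in> z ` (V - {u, v})"
      then obtain p where "p \<in> V" "p \<noteq> u" "p \<noteq> v" "z p = t" by auto
      moreover have "v \<in> V" using E_V[OF E_sym[OF edge]] .
      ultimately show False using inj_onD[OF that(2), of p v] by simp
    qed
    show "run E (z(u := s, v := t)) xs {u} = run E (z(u := -1, v := t)) xs {u}"
      using uv by (intro run_rank_cong[OF inj[OF that(1) new] that(2)]) auto
  qed
  show ?thesis
  proof (rule that)
    show "0 \<le> \<tau>" unfolding \<tau>_def by (rule cSup_upper[OF _ bdd]) simp
    show "\<tau> \<le> 1" unfolding \<tau>_def by (rule cSup_least) (auto simp: D_def)
  next
    fix s t :: real
    assume t: "0 \<le> t" and i: "inj_on (z(u := s, v := t)) V" and less: "t < \<tau>"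
    \<comment> \<open>Some rank in \<open>D\<close> exceeds \<open>t\<close>; lowering the rank of
      \<open>v\<close> to \<open>t\<close> keeps it matched.\<close>
    have "\<exists>d\<in>insert 0 D. t < d" using less unfolding \<tau>_def by (intro less_cSupD) simp
    then obtain d where "d \<in> insert 0 D" "t < d" by blast
    with t have d: "d \<in> D" "t < d" by auto
    have "v \<in> run E (z(u := -1, v := t)) xs {u}"
    proof (rule run_smaller_rank)
      show "inj_on (z(u := -1, v := d)) V" using d inj[of d] by (auto simp: D_def)
      show "inj_on (z(u := -1, v := t)) V" by (rule inj[OF t new[OF t i]])
      show "v \<in> run E (z(u := -1, v := d)) xs {u}" using d by (auto simp: D_def)
    qed (use d v in auto)
    then show "v \<in> run E (z(u := s, v := t)) xs {u}" using eq[OF t i] by simp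
  next
    fix s t :: real
    assume t: "0 \<le> t" "t < 1" and i: "inj_on (z(u := s, v := t)) V" and "\<tau> < t"
    have "t \<notin> D"
    proof
      assume "t \<in> D"
      then have "t \<le> \<tau>" unfolding \<tau>_def by (intro cSup_upper[OF _ bdd]) simp
      then show False using \<open>\<tau> < t\<close> by simp
    qed
    then show "v \<notin> run E (z(u := s, v := t)) xs {u}"
      using eq[OF t(1) i] new[OF t(1) i] t by (simp add: D_def)
  qed
qed

text \<open>Neither the fate of \<open>u\<close> before its deadline with \<open>v\<close> deleted
  nor the set \<open>N\<close> of neighbours left when both are deleted depends on the rank
  \<open>t\<close> of \<open>v\<close>. In each resulting case an explicit minorant
  \<open>?h t\<close> of the joint gain is integrated over \<open>t\<close>.\<close>

lemma second_rank_bound: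
  assumes z: "inj_on z (V - {u, v})" "z ` (V - {u, v}) \<subseteq> {0..<1}"
    and edge: "E u v" and u: "u \<notin> set xs" and v: "v \<notin> set xs"
    and s: "0 \<le> s" "s \<notin> z ` (V - {u, v})"
    and \<tau>: "0 \<le> \<tau>" "\<tau> \<le> 1"
    and below: "\<And>t. 0 \<le> t \<Longrightarrow> t < 1 \<Longrightarrow> inj_on (z(u := s, v := t)) V \<Longrightarrow> t < \<tau> \<Longrightarrow>
       v \<in> run E (z(u := s, v := t)) xs {u}"
    and above: "\<And>t. 0 \<le> t \<Longrightarrow> t < 1 \<Longrightarrow> inj_on (z(u := s, v := t)) V \<Longrightarrow> \<tau> < t \<Longrightarrow>
       v \<notin> run E (z(u := s, v := t)) xs {u}"
  shows "ennreal (price_int \<tau> + min (price s) (cap \<tau>)) \<le>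
    (\<integral>\<^sup>+t. ennreal (gain E (xs @ u # zs) (z(u := s, v := t)) u
       + gain E (xs @ u # zs) (z(u := s, v := t)) v) \<partial>unif)"
proof -
  let ?y = "\<lambda>t. z(u := s, v := t)"
  let ?g = "\<lambda>t w. gain E (xs @ u # zs) (?y t) w"
  have uv: "u \<noteq> v" using edge E_side by auto
  have inj: "inj_on (?y t) V" if "t \<noteq> s" "t \<notin> z ` (V - {u, v})" for t
    using inj_on_two_updates[OF z(1) s(2) that(2)] that(1) by simp
  note gains = gain_nonneg[of E "xs @ u # zs"]
  have inj0: "inj_on (?y (-1)) V" by (rule inj) (use s z(2) in force)+
  have eq: "run E (?y t) xs X = run E (?y (-1)) xs X" if "inj_on (?y t) V" "v \<in> X" for t X
    using that(2) by (intro run_rank_cong[OF inj0 that(1)]) auto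
  define N where "N = avail E u (run E (?y (-1)) xs {u, v})"
  have N: "avail E u (run E (?y t) xs {u, v}) = N" if "inj_on (?y t) V" for t
    unfolding N_def using eq[OF that] by simp
  have "N \<subseteq> V - {u, v}"
    using avail_subset[of u] run_mono[of "{u, v}" E "?y (-1)" xs] by (auto simp: N_def avail_def)
  define excluded where "excluded = {s} \<union> z ` (V - {u, v})"
  have fin: "finite excluded" using finite_V by (simp add: excluded_def)
  have ranks: "0 \<le> t \<and> t < 1 \<and> inj_on (?y t) V"
    if "0 \<le> t" "t < 1" "t \<notin> excluded" for t
    using that inj by (auto simp: excluded_def)
  have v_gain: "price t \<le> ?g t v" if "0 \<le> t" "t < 1" "t \<notin> excluded" "t < \<tau>" for t
    using gain_second_passive[OF _ edge u v below] ranks[OF that(1-3)] that uv by fastforce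
  consider (early) "u \<in> run E (?y (-1)) xs {v}"
    | (alone) "u \<notin> run E (?y (-1)) xs {v}" "N = {}"
    | (rival) "u \<notin> run E (?y (-1)) xs {v}" "N \<noteq> {}" by blast
  then show ?thesis
  proof cases
    case early
    \<comment> \<open>\<open>u\<close> is passive at every rank of \<open>v\<close>; below
      \<open>\<tau>\<close> the price of \<open>v\<close> is added.\<close>
    let ?h = "\<lambda>t. indicator {..<\<tau>} t * price t + price s"
    have ae: "AE t in unif. ?h t \<le> ?g t u + ?g t v"
    proof (rule AE_unif[OF fin])
      fix t assume t: "0 \<le> t" "t < 1" "t \<notin> excluded"
      have "price (?y t u) \<le> ?g t u"
        using gain_first_passive[OF _ edge u v, of "?y t"] eq[of t "{v}"] ranks[OF t] early by simp
      then show "?h t \<le> ?g t u + ?g t v"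
        using uv v_gain[OF t] gains[of "?y t" v] by (auto simp: indicator_def)
    qed
    have int: "integrable unif ?h"
      by (intro Bochner_Integration.integrable_add integrable_price unif.integrable_const)
    have eq: "(\<integral>t. ?h t \<partial>unif) = price_int \<tau> + price s"
      using integrable_price by (simp add: price_int_def unif.prob_space)
    have le: "price_int \<tau> + min (price s) (cap \<tau>) \<le> price_int \<tau> + price s" by simp
    show ?thesis by (rule nn_integral_unif_ge[OF int ae]) (simp only: eq le)
  next
    case alone
    \<comment> \<open>Above \<open>\<tau>\<close> the vertex \<open>u\<close> has no choice but
      \<open>v\<close>; below, only the price of \<open>v\<close> is counted.\<close>
    let ?h = "\<lambda>t. indicator {..<\<tau>} t * price t + (1 - indicator {..<\<tau>} t * 1)"
    have ae: "AE t in unif. ?h t \<le> ?g t u + ?g t v"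
    proof (rule AE_unif[of "insert \<tau> excluded"])
      fix t assume "0 \<le> t" "t < 1" "t \<notin> insert \<tau> excluded"
      then have t: "0 \<le> t" "t < 1" "t \<notin> excluded" "t \<noteq> \<tau>" by auto
      have "1 \<le> ?g t u + ?g t v" if "\<tau> < t"
        using gain_edge_matched[OF _ edge u v, of "?y t"] eq[of t "{v}"] above[of t]
          ranks[OF t(1-3)] alone N[of t] that by simp
      then show "?h t \<le> ?g t u + ?g t v"
        using t(4) v_gain[OF t(1-3)] gains[of "?y t" u] by (cases "t < \<tau>") (auto simp: indicator_def)
    qed (simp add: fin)
    have int: "integrable unif ?h"
      by (intro Bochner_Integration.integrable_add Bochner_Integration.integrable_diff
          integrable_price integrable_indicator_unif unif.integrable_const)
    have eq: "(\<integral>t. ?h t \<partial>unif) = price_int \<tau> + (1 - \<tau>)"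
    proof -
      have "(\<integral>t. ?h t \<partial>unif) = (\<integral>t. indicator {..<\<tau>} t * price t \<partial>unif)
          + ((\<integral>t. 1 \<partial>unif) - (\<integral>t. indicator {..<\<tau>} t * 1 \<partial>unif))"
        using integrable_price integrable_indicator_unif[of _ 1]
        by (subst Bochner_Integration.integral_add Bochner_Integration.integral_diff;
            (intro Bochner_Integration.integrable_diff)?; simp?)+
      then show ?thesis using integral_indicator_unif[OF \<tau>, of 1] by (simp add: price_int_def unif.prob_space)
    qed
    have le: "price_int \<tau> + min (price s) (cap \<tau>) \<le> price_int \<tau> + (1 - \<tau>)"
      using cap_le[OF \<tau>] by simp
    show ?thesis by (rule nn_integral_unif_ge[OF int ae]) (simp only: eq le)
  next
    case rival
    have "finite N" unfolding N_def by (rule finite_avail)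
    define p where "p = arg_min_on z N"
    have p: "p \<in> N" "\<And>q. q \<in> N \<Longrightarrow> z p \<le> z q"
      unfolding p_def using arg_min_if_finite(1)[OF \<open>finite N\<close> rival(2)] arg_min_least[OF \<open>finite N\<close> rival(2)]
      by auto
    have pz: "?y t q = z q" if "q \<in> N" for q t using that \<open>N \<subseteq> V - {u, v}\<close> by auto
    \<comment> \<open>Between \<open>\<tau>\<close> and \<open>\<beta>\<close> the vertex
      \<open>v\<close> is still free at the deadline of \<open>u\<close> and beats the best rival
      \<open>p\<close>.\<close>
    define \<beta> where "\<beta> = max \<tau> (z p)"
    have "z p \<in> z ` (V - {u, v})" using p(1) \<open>N \<subseteq> V - {u, v}\<close> by blast
    then have "z p < 1" using z(2) by auto
    then have \<beta>: "\<tau> \<le> \<beta>" "\<beta> \<le> 1" using \<tau> by (auto simp: \<beta>_def)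
    have price_p: "price (z p) \<le> price \<beta>" by (rule price_mono) (simp add: \<beta>_def)
    define m where "m = min (price s) (1 - price \<beta>)"
    \<comment> \<open>Its values are \<open>price t + m\<close> below \<open>\<tau>\<close>, 1
      between \<open>\<tau>\<close> and \<open>\<beta>\<close>, and \<open>1 - price \<beta>\<close>
      above \<open>\<beta>\<close>.\<close>
    let ?h = "\<lambda>t. indicator {..<\<tau>} t * price t + (indicator {..<\<tau>} t * (m - 1)
      + (indicator {..<\<beta>} t * price \<beta> + (1 - price \<beta>)))"
    have ae: "AE t in unif. ?h t \<le> ?g t u + ?g t v"
    proof (rule AE_unif[of "insert \<tau> (insert \<beta> excluded)"])
      fix t assume "0 \<le> t" "t < 1" "t \<notin> insert \<tau> (insert \<beta> excluded)"
      then have t: "0 \<le> t" "t < 1" "t \<notin> excluded" "t \<noteq> \<tau>" "t \<noteq> \<beta>" by auto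
      have i: "inj_on (?y t) V" using ranks[OF t(1-3)] by simp
      have not_u: "u \<notin> run E (?y t) xs {v}" using eq[OF i, of "{v}"] rival by simp
      have pN: "p \<in> avail E u (run E (?y t) xs {u, v})" using N[OF i] p(1) by simp
      consider "t < \<tau>" | "\<tau> < t" "t < \<beta>" | "\<tau> < t" "\<beta> < t" using t by linarith
      then show "?h t \<le> ?g t u + ?g t v"
      proof cases
        case 1
        have "min (price s) (1 - price (z p)) \<le> ?g t u"
          using gain_first_not_passive[OF i edge u v not_u pN] pz[OF p(1)] uv by simp
        then have "m \<le> ?g t u" using price_p by (auto simp: m_def)
        then show ?thesis using 1 v_gain[OF t(1-3)] \<beta> by (auto simp: indicator_def)
      next
        case 2
        then have "\<beta> = z p" by (auto simp: \<beta>_def max_def split: if_splits)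
        then have "1 \<le> ?g t u + ?g t v"
          using 2 p(2) pz N[OF i] above[OF t(1,2) i]
          by (intro gain_edge_matched[OF i edge u v not_u]) force+
        then show ?thesis using 2 by (auto simp: indicator_def)
      next
        case 3
        then have "1 - price (z p) \<le> ?g t u"
          using gain_first_active[OF i edge u v not_u above[OF t(1,2) i] pN] pz[OF p(1)] by simp
        then show ?thesis using 3 price_p gains[of "?y t" v] by (auto simp: indicator_def)
      qed
    qed (simp add: fin)
    have int: "integrable unif ?h"
      by (intro Bochner_Integration.integrable_add
          integrable_price integrable_indicator_unif unif.integrable_const)
    have eq: "(\<integral>t. ?h t \<partial>unif) = price_int \<tau> + (\<tau> * (m - 1) + (\<beta> * price \<beta> + (1 - price \<beta>)))"
    proof -
      have i3: "integrable unif (\<lambda>t. indicator {..<\<beta>} t * price \<beta> + (1 - price \<beta>))"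
        by (intro Bochner_Integration.integrable_add integrable_indicator_unif unif.integrable_const)
      have i2: "integrable unif (\<lambda>t. indicator {..<\<tau>} t * (m - 1)
          + (indicator {..<\<beta>} t * price \<beta> + (1 - price \<beta>)))"
        by (intro Bochner_Integration.integrable_add integrable_indicator_unif i3)
      have "(\<integral>t. ?h t \<partial>unif) = (\<integral>t. indicator {..<\<tau>} t * price t \<partial>unif)
          + ((\<integral>t. indicator {..<\<tau>} t * (m - 1) \<partial>unif)
          + ((\<integral>t. indicator {..<\<beta>} t * price \<beta> \<partial>unif) + (\<integral>t. 1 - price \<beta> \<partial>unif)))"
        unfolding Bochner_Integration.integral_add[OF integrable_price i2]
          Bochner_Integration.integral_add[OF integrable_indicator_unif i3]
          Bochner_Integration.integral_add[OF integrable_indicator_unif unif.integrable_const] ..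
      then show ?thesis
        unfolding integral_indicator_unif[OF \<tau>] integral_indicator_unif[OF order_trans[OF \<tau>(1) \<beta>(1)] \<beta>(2)]
        by (simp add: price_int_def unif.prob_space)
    qed
    have le: "price_int \<tau> + min (price s) (cap \<tau>)
        \<le> price_int \<tau> + (\<tau> * (m - 1) + (\<beta> * price \<beta> + (1 - price \<beta>)))"
      using cap_le_step[OF \<tau>(1) \<beta>, of "price s"] by (simp add: m_def algebra_simps)
    show ?thesis by (rule nn_integral_unif_ge[OF int ae]) (simp only: eq le)
  qed
qed

text \<open>Fubini integrates the rank of \<open>v\<close> first, by
  \<open>second_rank_bound\<close>, then that of \<open>u\<close>, by \<open>price_int_cap\<close>,
  and the remaining ranks last.\<close>

lemma expected_edge_gain_ordered:
  assumes edge: "E u v" and u: "u \<notin> set xs" and v: "v \<notin> set xs"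
  shows "ennreal omega_const \<le> (\<integral>\<^sup>+y. ennreal (gain E (xs @ u # zs) y u + gain E (xs @ u # zs) y v)
    \<partial>PiM V (\<lambda>_. unif))"
proof -
  let ?J = "V - {u, v}" and ?M = "\<lambda>_. unif"
  let ?f = "\<lambda>y. ennreal (gain E (xs @ u # zs) y u + gain E (xs @ u # zs) y v)"
  have uv: "u \<noteq> v" using edge E_side by auto
  have V: "V = insert v (insert u ?J)" using E_V[OF edge] E_V[OF E_sym[OF edge]] by auto
  have "?f \<in> borel_measurable (PiM V ?M)" by measurable
  then have f: "?f \<in> borel_measurable (PiM (insert v (insert u ?J)) ?M)" using V by simp
  have "(\<lambda>y. \<integral>\<^sup>+t. ?f (y(v := t)) \<partial>unif) \<in> borel_measurable (PiM (insert u ?J) ?M)"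
  proof (rule unif.borel_measurable_nn_integral)
    have "(\<lambda>(y, t). y(v := t)) \<in> measurable (PiM (insert u ?J) ?M \<Otimes>\<^sub>M unif) (PiM (insert v (insert u ?J)) ?M)"
      by (rule measurable_add_dim)
    from measurable_compose[OF this f]
    show "(\<lambda>(y, t). ?f (y(v := t))) \<in> borel_measurable (PiM (insert u ?J) ?M \<Otimes>\<^sub>M unif)"
      by (simp add: case_prod_beta')
  qed
  then have "(\<integral>\<^sup>+y. (\<integral>\<^sup>+t. ?f (y(v := t)) \<partial>unif) \<partial>PiM (insert u ?J) ?M)
      = (\<integral>\<^sup>+z. (\<integral>\<^sup>+s. (\<integral>\<^sup>+t. ?f (z(u := s, v := t)) \<partial>unif) \<partial>unif) \<partial>PiM ?J ?M)"
    by (rule unif_prod.product_nn_integral_insert[rotated 2]) (use finite_V in auto)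
  moreover have "(\<integral>\<^sup>+y. ?f y \<partial>PiM (insert v (insert u ?J)) ?M)
      = (\<integral>\<^sup>+y. (\<integral>\<^sup>+t. ?f (y(v := t)) \<partial>unif) \<partial>PiM (insert u ?J) ?M)"
    using f by (rule unif_prod.product_nn_integral_insert[rotated 2]) (use finite_V uv in auto)
  ultimately have split: "(\<integral>\<^sup>+y. ?f y \<partial>PiM V ?M)
      = (\<integral>\<^sup>+z. (\<integral>\<^sup>+s. (\<integral>\<^sup>+t. ?f (z(u := s, v := t)) \<partial>unif) \<partial>unif) \<partial>PiM ?J ?M)"
    using V by simp
  have inner: "ennreal omega_const \<le> (\<integral>\<^sup>+s. (\<integral>\<^sup>+t. ?f (z(u := s, v := t)) \<partial>unif) \<partial>unif)"
    if z: "inj_on z ?J" "z ` ?J \<subseteq> {0..<1}" for z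
  proof -
    \<comment> \<open>\<open>\<tau>\<close> is fixed before the rank \<open>s\<close> of
      \<open>u\<close>, so the same threshold serves the whole integral over
      \<open>s\<close>.\<close>
    obtain \<tau> where \<tau>: "0 \<le> \<tau>" "\<tau> \<le> 1"
      and below: "\<And>s t. 0 \<le> s \<Longrightarrow> 0 \<le> t \<Longrightarrow> t < 1 \<Longrightarrow> inj_on (z(u := s, v := t)) V \<Longrightarrow> t < \<tau> \<Longrightarrow>
        v \<in> run E (z(u := s, v := t)) xs {u}"
      and above: "\<And>s t. 0 \<le> s \<Longrightarrow> 0 \<le> t \<Longrightarrow> t < 1 \<Longrightarrow> inj_on (z(u := s, v := t)) V \<Longrightarrow> \<tau> < t \<Longrightarrow>
        v \<notin> run E (z(u := s, v := t)) xs {u}"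
      using second_rank_threshold[OF z edge u v] by blast
    let ?h = "\<lambda>s. price_int \<tau> + min (price s) (cap \<tau>)"
    have cap: "0 \<le> cap \<tau>" using omega_const \<tau> by (auto simp: cap_def)
    have price_int: "0 \<le> price_int \<tau>"
      unfolding price_int_def by (intro integral_nonneg_AE) (auto simp: price_nonneg)
    have "integrable unif (\<lambda>s. min (price s) (cap \<tau>))"
      using cap price_nonneg price_le_1
      by (intro integrable_unif_bounded[of _ 1]) (auto simp: min_le_iff_disj abs_of_nonneg)
    then have int: "integrable unif ?h" by simp
    have "ennreal omega_const \<le> ennreal (\<integral>s. ?h s \<partial>unif)"
      by (rule ennreal_leI) (rule price_int_cap[OF \<tau>])
    also have "\<dots> = (\<integral>\<^sup>+s. ennreal (?h s) \<partial>unif)"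
      using int cap price_int price_nonneg by (intro nn_integral_eq_integral[symmetric]) auto
    also have "\<dots> \<le> (\<integral>\<^sup>+s. (\<integral>\<^sup>+t. ?f (z(u := s, v := t)) \<partial>unif) \<partial>unif)"
    proof (rule nn_integral_mono_AE, rule AE_unif)
      show "finite (z ` ?J)" using finite_V by simp
      fix s :: real assume s: "0 \<le> s" "s < 1" "s \<notin> z ` ?J"
      show "ennreal (?h s) \<le> (\<integral>\<^sup>+t. ?f (z(u := s, v := t)) \<partial>unif)"
        by (rule second_rank_bound[OF z edge u v s(1,3) \<tau> below[OF s(1)] above[OF s(1)]])
    qed
    finally show ?thesis .
  qed
  interpret J: prob_space "PiM ?J ?M" by (rule prob_space_unif_prod)
  have "ennreal omega_const = (\<integral>\<^sup>+z. ennreal omega_const \<partial>PiM ?J ?M)"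
    by (simp add: J.emeasure_space_1)
  also have "\<dots> \<le> (\<integral>\<^sup>+z. (\<integral>\<^sup>+s. (\<integral>\<^sup>+t. ?f (z(u := s, v := t)) \<partial>unif) \<partial>unif) \<partial>PiM ?J ?M)"
  proof (rule nn_integral_mono_AE)
    have "AE z in PiM ?J ?M. inj_on z ?J \<and> z ` ?J \<subseteq> {0..<1}"
      using finite_V by (intro AE_unif_prod) simp
    then show "AE z in PiM ?J ?M. ennreal omega_const \<le> (\<integral>\<^sup>+s. (\<integral>\<^sup>+t. ?f (z(u := s, v := t)) \<partial>unif) \<partial>unif)"
      by eventually_elim (rule inner, auto)
  qed
  finally show ?thesis unfolding split .
qed

text \<open>The endpoint with the earlier deadline plays the role of \<open>u\<close>.\<close>

lemma expected_edge_gain: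
  assumes "E u v" "distinct ds" "u \<in> set ds" "v \<in> set ds"
  shows "ennreal omega_const \<le> (\<integral>\<^sup>+y. ennreal (gain E ds y u + gain E ds y v) \<partial>PiM V (\<lambda>_. unif))"
proof -
  have uv: "u \<noteq> v" using assms(1) E_side by auto
  obtain xs zs where ds: "ds = xs @ u # zs" using assms(3) by (auto dest: split_list)
  show ?thesis
  proof (cases "v \<in> set xs")
    case False
    then show ?thesis using expected_edge_gain_ordered[OF assms(1), of xs zs] assms(2) ds by simp
  next
    case True
    then obtain xs' ys where xs: "xs = xs' @ v # ys" by (auto dest: split_list)
    then show ?thesis
      using expected_edge_gain_ordered[OF E_sym[OF assms(1)], of xs' "ys @ u # zs"] assms(2) ds
      by (simp add: add.commute)
  qed
qed

section \<open>Summation over a maximum matching\<close>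

lemma matching_subset_Pow:
  assumes "is_matching E M"
  shows "M \<subseteq> Pow V"
proof
  fix e assume "e \<in> M"
  then have "\<exists>u v. e = {u, v} \<and> E u v" using assms by (simp add: is_matching_def)
  then obtain u v where "e = {u, v}" "E u v" by blast
  then show "e \<in> Pow V" using E_V[of u v] E_V[OF E_sym, of u v] by simp
qed

lemma max_matching_obtain:
  obtains M where "is_matching E M" "card M = max_matching_size E"
proof -
  have "finite {M. is_matching E M}"
    by (rule finite_subset[of _ "Pow (Pow V)"]) (use matching_subset_Pow finite_V in \<open>simp_all add: subset_iff\<close>)
  moreover have "is_matching E {}" by (simp add: is_matching_def)
  ultimately have "max_matching_size E \<in> card ` {M. is_matching E M}"
    unfolding max_matching_size_def by (intro Max_in) auto
  then show ?thesis using that by auto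
qed

text \<open>The edges of a matching are disjoint, so their joint gains add up to at most the total
  gain over \<open>V\<close>, while each contributes \<open>omega_const\<close> in
  expectation.\<close>

lemma expected_gain_ge_matching:
  assumes "is_matching E M" "distinct ds" "set ds = V"
  shows "ennreal (omega_const * real (card M))
    \<le> (\<integral>\<^sup>+y. ennreal (\<Sum>x\<in>V. gain E ds y x) \<partial>PiM V (\<lambda>_. unif))"
proof -
  have M: "M \<subseteq> Pow V" by (rule matching_subset_Pow[OF assms(1)])
  have edges: "ennreal omega_const \<le> (\<integral>\<^sup>+y. ennreal (\<Sum>x\<in>e. gain E ds y x) \<partial>PiM V (\<lambda>_. unif))"
    if e: "e \<in> M" for e
  proof -
    have "\<exists>u v. e = {u, v} \<and> E u v" using assms(1) e by (simp add: is_matching_def)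
    then obtain u v where uv: "e = {u, v}" "E u v" by blast
    moreover have "u \<noteq> v" using uv(2) E_side by auto
    ultimately show ?thesis
      using expected_edge_gain[OF uv(2) assms(2)] assms(3) E_V[OF uv(2)] E_V[OF E_sym[OF uv(2)]]
      by simp
  qed
  have "ennreal (omega_const * real (card M)) = (\<Sum>e\<in>M. ennreal omega_const)"
    using omega_const by (simp add: ennreal_mult mult.commute ennreal_of_nat_eq_real_of_nat)
  also have "\<dots> \<le> (\<Sum>e\<in>M. \<integral>\<^sup>+y. ennreal (\<Sum>x\<in>e. gain E ds y x) \<partial>PiM V (\<lambda>_. unif))"
    by (rule sum_mono) (rule edges)
  also have "\<dots> = (\<integral>\<^sup>+y. (\<Sum>e\<in>M. ennreal (\<Sum>x\<in>e. gain E ds y x)) \<partial>PiM V (\<lambda>_. unif))"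
    by (rule nn_integral_sum[symmetric]) measurable
  also have "\<dots> \<le> (\<integral>\<^sup>+y. ennreal (\<Sum>x\<in>V. gain E ds y x) \<partial>PiM V (\<lambda>_. unif))"
  proof (rule nn_integral_mono)
    fix y
    have "(\<Sum>e\<in>M. \<Sum>x\<in>e. gain E ds y x) = (\<Sum>x\<in>\<Union>M. gain E ds y x)"
    proof (rule sum.Union_disjoint[symmetric, unfolded comp_def])
      show "\<forall>e\<in>M. finite e" using M finite_V by (auto intro: finite_subset)
      show "\<forall>e\<in>M. \<forall>e'\<in>M. e \<noteq> e' \<longrightarrow> e \<inter> e' = {}"
        using assms(1) by (simp add: is_matching_def)
    qed
    also have "\<dots> \<le> (\<Sum>x\<in>V. gain E ds y x)"
      using M finite_V by (intro sum_mono2) (auto simp: gain_nonneg)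
    finally show "(\<Sum>e\<in>M. ennreal (\<Sum>x\<in>e. gain E ds y x)) \<le> ennreal (\<Sum>x\<in>V. gain E ds y x)"
      by (subst sum_ennreal) (auto intro: ennreal_leI sum_nonneg gain_nonneg)
  qed
  finally show ?thesis .
qed

text \<open>The total gain is the size of the matching; bounded by the number of deadlines, it is
  integrable, so the nonnegative integral is the expectation.\<close>

lemma expected_ranking_ge:
  assumes "distinct (deadlines evs)" "set (deadlines evs) = V"
  shows "omega_const * real (max_matching_size E) \<le> (\<integral>y. real (card (ranking E evs y)) \<partial>rank_space V)"
proof -
  let ?P = "PiM V (\<lambda>_. unif)"
  interpret P: prob_space ?P by (rule prob_space_unif_prod)
  let ?f = "\<lambda>y. \<Sum>x\<in>V. gain E (deadlines evs) y x"
  obtain M where M: "is_matching E M" "card M = max_matching_size E" by (rule max_matching_obtain)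
  have length_le: "length (match_list E y ds X) \<le> length ds" for y ds X
    by (induction ds arbitrary: X) (auto simp: le_SucI)
  have "\<bar>?f y\<bar> \<le> real (length (deadlines evs))" for y
    using length_le unfolding sum_gain by simp
  then have int: "integrable ?P ?f"
    by (intro P.integrable_const_bound) auto
  have "ennreal (omega_const * real (card M)) \<le> (\<integral>\<^sup>+y. ennreal (?f y) \<partial>?P)"
    by (rule expected_gain_ge_matching[OF M(1) assms])
  also have "\<dots> = ennreal (\<integral>y. ?f y \<partial>?P)"
    using int by (intro nn_integral_eq_integral) (auto intro: sum_nonneg gain_nonneg)
  finally have "omega_const * real (card M) \<le> (\<integral>y. ?f y \<partial>?P)"
    by (subst (asm) ennreal_le_iff) (auto intro!: integral_nonneg_AE sum_nonneg gain_nonneg)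
  then show ?thesis unfolding M(2) rank_space_def card_ranking .
qed

end

theorem theorem4p1:
  fixes V :: "'a set" and E :: "'a \<Rightarrow> 'a \<Rightarrow> bool" and evs :: "'a event list"
  assumes "simple_graph V E"
    and "bipartite V E"
    and "fully_online_instance V E evs"
  shows "(\<integral>y. real (card (ranking E evs y)) \<partial>rank_space V)
           \<ge> omega_const * real (max_matching_size E)"
proof -
  obtain L R where "L \<inter> R = {}"
    and LR: "\<And>u v. E u v \<Longrightarrow> (u \<in> L \<and> v \<in> R) \<or> (u \<in> R \<and> v \<in> L)"
    using assms(2) unfolding bipartite_def by blast
  interpret bipartite_graph V E "\<lambda>x. x \<in> L"
  proof
    show "(u \<in> L) \<noteq> (v \<in> L)" if "E u v" for u v
      using LR[OF that] \<open>L \<inter> R = {}\<close> by blast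
  qed (use assms(1) in \<open>auto simp: simple_graph_def\<close>)
  show ?thesis
  proof (rule expected_ranking_ge)
    show "distinct (deadlines evs)"
      using assms(3) by (auto simp: fully_online_instance_def distinct_deadlines)
    show "set (deadlines evs) = V"
      using assms(3) by (auto simp: fully_online_instance_def set_deadlines)
  qed
qed

end
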